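(* For $\overline{\Sigma}_r\subset\mathrm{Hom}(\mathbb{C}^n,\mathbb{C}^{n+k})$, the polar variety $\Gamma^u(\overline{\Sigma}_r)$ of dimension $u$ is empty for $u\le (n-r)(n+k-r)-1$.
   Context: $\overline{\Sigma}_r$ is the set of matrices in $\mathrm{Hom}(\mathbb{C}^n,\mathbb{C}^{n+k})$ whose kernel has dimension $r$ or more. Let $h=n(n+k)$. The conormal space $C(\overline{\Sigma}_r)\subset\overline{\Sigma}_r\times\mathbb{P}^{h-1}$ is the closure of the set of pairs (smooth point, tangent hyperplane at that point). Upper index denotes dimension: $\Gamma^u(\overline{\Sigma}_r)$ is the polar variety of dimension $u$, i.e. the projection to $\overline{\Sigma}_r$ of the intersection of $C(\overline{\Sigma}_r)$ with $\overline{\Sigma}_r\times H$, where $H\subset\mathbb{P}^{h-1}$ is the intersection of $h-1-u$ generic hyperplanes. *)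

theory Defs
  imports "HOL-Analysis.Analysis"
begin

text \<open>
  The space Hom(C^n, C^m) is \<^typ>\<open>complex^'n^'m\<close> with \<open>n = CARD('n)\<close> and \<open>m = CARD('m)\<close>; a matrix
  \<open>A\<close> acts by \<^term>\<open>(*v) A\<close>. The library provides only the real scalar multiplication on this type,
  so its structure of a complex vector space is set up here.
\<close>

definition cscale :: "complex \<Rightarrow> complex^'n^'m \<Rightarrow> complex^'n^'m" where
  "cscale c A = (\<chi> i j. c * A $ i $ j)"

interpretation cmat: vector_space "cscale :: complex \<Rightarrow> complex^'n^'m \<Rightarrow> complex^'n^'m"
  by unfold_locales (simp_all add: cscale_def vec_eq_iff algebra_simps)

text \<open>
  The bilinear (not Hermitian) pairing that identifies linear forms on Hom(C^n, C^m) with matrices.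
\<close>

definition pairing :: "complex^'n^'m \<Rightarrow> complex^'n^'m \<Rightarrow> complex" where
  "pairing A B = (\<Sum>i\<in>UNIV. \<Sum>j\<in>UNIV. A $ i $ j * B $ i $ j)"

definition Sigma_bar :: "nat \<Rightarrow> (complex^'n^'m) set" where
  "Sigma_bar r = {A. r \<le> vec.dim {v. A *v v = 0}}"


subsection \<open>Smooth points and tangent spaces\<close>

definition holomorphic_map_on ::
  "(complex^'n^'m \<Rightarrow> complex^'n^'m) \<Rightarrow> (complex^'n^'m) set \<Rightarrow> bool" where
  "holomorphic_map_on f U \<longleftrightarrow>
     (\<forall>x\<in>U. \<exists>f'. (f has_derivative f') (at x) \<and> Vector_Spaces.linear cscale cscale f')"

definition biholomorphic_between ::
  "(complex^'n^'m) set \<Rightarrow> (complex^'n^'m) set \<Rightarrow> (complex^'n^'m \<Rightarrow> complex^'n^'m) \<Rightarrow> bool" where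
  "biholomorphic_between U V f \<longleftrightarrow>
     open U \<and> open V \<and> bij_betw f U V \<and>
     holomorphic_map_on f U \<and> holomorphic_map_on (inv_into U f) V"

text \<open>
  A smooth point of \<open>X\<close> is a point near which \<open>X\<close> is a complex submanifold of the ambient space.
\<close>

definition smooth_point :: "(complex^'n^'m) set \<Rightarrow> complex^'n^'m \<Rightarrow> bool" where
  "smooth_point X x \<longleftrightarrow> x \<in> X \<and>
     (\<exists>U V f L. x \<in> U \<and> biholomorphic_between U V f \<and> cmat.subspace L \<and> f ` (X \<inter> U) = L \<inter> V)"

text \<open>
  Velocities at \<open>x\<close> of curves in \<open>X\<close>. Only used at smooth points, where this is the usual
  (complex) tangent space of a submanifold.
\<close>

definition tangent_space :: "(complex^'n^'m) set \<Rightarrow> complex^'n^'m \<Rightarrow> (complex^'n^'m) set" where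
  "tangent_space X x =
     {v. \<exists>\<gamma>::real \<Rightarrow> complex^'n^'m. range \<gamma> \<subseteq> X \<and> \<gamma> 0 = x \<and> (\<gamma> has_vector_derivative v) (at 0)}"


subsection \<open>Projective space of hyperplanes\<close>

text \<open>
  The points of P^(h-1), where h = nm, are the complex lines spanned by nonzero matrices. The line
  spanned by \<open>N\<close> stands for the hyperplane of all \<open>v\<close> with \<open>pairing N v = 0\<close>.
\<close>

definition proj_space :: "(complex^'n^'m) set set" where
  "proj_space = {cmat.span {N} | N. N \<noteq> 0}"

text \<open>The quotient topology under the map that sends a nonzero matrix to the line it spans.\<close>

definition proj_topology :: "(complex^'n^'m) set topology" where
  "proj_topology = topology (\<lambda>W. W \<subseteq> proj_space \<and> open {N. N \<noteq> 0 \<and> cmat.span {N} \<in> W})"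

lemma openin_proj_topology:
  "openin proj_topology W \<longleftrightarrow>
     W \<subseteq> (proj_space :: (complex^'n^'m) set set) \<and> open {N. N \<noteq> 0 \<and> cmat.span {N} \<in> W}"
proof -
  have "istopology (\<lambda>W. W \<subseteq> (proj_space :: (complex^'n^'m) set set) \<and>
          open {N. N \<noteq> 0 \<and> cmat.span {N} \<in> W})"
    unfolding istopology_def
  proof (intro conjI allI impI)
    fix S T :: "(complex^'n^'m) set set"
    assume S: "S \<subseteq> proj_space \<and> open {N. N \<noteq> 0 \<and> cmat.span {N} \<in> S}"
       and T: "T \<subseteq> proj_space \<and> open {N. N \<noteq> 0 \<and> cmat.span {N} \<in> T}"
    show "S \<inter> T \<subseteq> proj_space" using S by blast
    have "{N. N \<noteq> 0 \<and> cmat.span {N} \<in> S \<inter> T} =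
        {N. N \<noteq> 0 \<and> cmat.span {N} \<in> S} \<inter> {N. N \<noteq> 0 \<and> cmat.span {N} \<in> T}" by blast
    then show "open {N. N \<noteq> 0 \<and> cmat.span {N} \<in> S \<inter> T}" using S T by (simp add: open_Int)
  next
    fix K :: "(complex^'n^'m) set set set"
    assume K: "\<forall>S\<in>K. S \<subseteq> proj_space \<and> open {N. N \<noteq> 0 \<and> cmat.span {N} \<in> S}"
    then show "\<Union>K \<subseteq> proj_space" by blast
    have "{N. N \<noteq> 0 \<and> cmat.span {N} \<in> \<Union>K} = (\<Union>S\<in>K. {N. N \<noteq> 0 \<and> cmat.span {N} \<in> S})"
      by blast
    then show "open {N. N \<noteq> 0 \<and> cmat.span {N} \<in> \<Union>K}" using K by auto
  qed
  then show ?thesis unfolding proj_topology_def by (simp add: topology_inverse')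
qed

definition conormal_space :: "(complex^'n^'m) set \<Rightarrow> ((complex^'n^'m) \<times> (complex^'n^'m) set) set" where
  "conormal_space X =
     prod_topology (top_of_set X) proj_topology closure_of
       {(x, cmat.span {N}) | x N.
          smooth_point X x \<and> N \<noteq> 0 \<and> tangent_space X x \<subseteq> {v. pairing N v = 0}}"


subsection \<open>Polar varieties\<close>

text \<open>For \<open>A \<noteq> 0\<close>, a hyperplane of P^(h-1).\<close>

definition proj_hyperplane :: "complex^'n^'m \<Rightarrow> (complex^'n^'m) set set" where
  "proj_hyperplane A = {cmat.span {N} | N. N \<noteq> 0 \<and> pairing A N = 0}"

text \<open>
  \<open>polar_variety X u A\<close> is cut out by the h - 1 - u hyperplanes given by \<open>A 0, A 1, ...\<close>; the
  polar variety of dimension \<open>u\<close> is the one obtained for generic \<open>A\<close>, with \<open>u \<le> h - 1\<close>.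
\<close>

definition polar_variety ::
  "(complex^'n^'m) set \<Rightarrow> nat \<Rightarrow> (nat \<Rightarrow> complex^'n^'m) \<Rightarrow> (complex^'n^'m) set" where
  "polar_variety X u A =
     fst ` (conormal_space X \<inter>
       X \<times> (proj_space \<inter> (\<Inter>i<CARD('n) * CARD('m) - 1 - u. proj_hyperplane (A i))))"


subsection \<open>Genericity\<close>

text \<open>The polynomials in the given coordinate functions, as functions.\<close>

inductive_set polynomials_in :: "('a \<Rightarrow> complex) set \<Rightarrow> ('a \<Rightarrow> complex) set"
  for C :: "('a \<Rightarrow> complex) set" where
  coord: "f \<in> C \<Longrightarrow> f \<in> polynomials_in C"
| const: "(\<lambda>_. c) \<in> polynomials_in C"
| add: "f \<in> polynomials_in C \<Longrightarrow> g \<in> polynomials_in C \<Longrightarrow> (\<lambda>x. f x + g x) \<in> polynomials_in C"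
| mult: "f \<in> polynomials_in C \<Longrightarrow> g \<in> polynomials_in C \<Longrightarrow> (\<lambda>x. f x * g x) \<in> polynomials_in C"

text \<open>
  A \<open>d\<close>-tuple of matrices is the restriction of a function on \<^typ>\<open>nat\<close> to the arguments \<open>i < d\<close>:
  the coordinates below see only these.
\<close>

definition zariski_closed_tuples :: "nat \<Rightarrow> (nat \<Rightarrow> complex^'n^'m) set \<Rightarrow> bool" where
  "zariski_closed_tuples d Z \<longleftrightarrow>
     (\<exists>F \<subseteq> polynomials_in {\<lambda>A. A i $ a $ b | i a b. i < d}. Z = {A. \<forall>f\<in>F. f A = 0})"

text \<open>
  \<open>P\<close> holds for \<open>d\<close> generic hyperplanes if it holds for all \<open>d\<close>-tuples of hyperplanes outside some
  proper Zariski closed set. The hyperplanes are represented by their equations \<open>A i \<noteq> 0\<close>; since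
  \<open>P\<close> will depend only on the hyperplanes, not on the choice of equations, using Zariski closed sets
  of tuples of equations amounts to using those of the d-fold product of the dual of P^(h-1).
\<close>

definition for_generic_hyperplanes :: "nat \<Rightarrow> ((nat \<Rightarrow> complex^'n^'m) \<Rightarrow> bool) \<Rightarrow> bool" where
  "for_generic_hyperplanes d P \<longleftrightarrow>
     (\<exists>Z. zariski_closed_tuples d Z \<and> Z \<noteq> UNIV \<and>
        (\<forall>A. (\<forall>i<d. A i \<noteq> 0) \<longrightarrow> A \<notin> Z \<longrightarrow> P A))"

end

theory Submission
  imports Defs "HOL-Computational_Algebra.Polynomial" "HOL-Library.Function_Algebras"
begin

text \<open>
  Write \<open>n\<close>, \<open>m\<close> for the numbers of columns and rows. The matrices \<open>A\<close> with a kernel of dimension at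
  least \<open>r\<close> have the property that a conormal vector \<open>N\<close> at \<open>A\<close> has rank at most \<open>r\<close>. Two families
  of lines through \<open>A\<close> show this. Adding to a row of \<open>A\<close> a multiple of a row of \<open>A\<close> does not shrink
  the kernel, so these directions are tangent, and the pairings with \<open>N\<close> say that every row of \<open>N\<close>
  lies in the kernel of \<open>A\<close> (\<open>conormal_rows_in_kernel\<close>). If that kernel had dimension greater than
  \<open>r\<close>, then changing a single entry of \<open>A\<close> would leave a kernel of dimension at least \<open>r\<close>, so all
  directions of the standard basis would be tangent and \<open>N\<close> would vanish (\<open>conormal_kernel_dim\<close>).
  Rank at most \<open>r\<close> is a closed condition, so it passes to the closure that defines the conormal
  space (\<open>conormal_space_row_rank_le\<close>).

  The matrices of rank at most \<open>r\<close> form a cone of dimension \<open>r (n + m - r)\<close>. The bound on \<open>u\<close> says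
  exactly that the number \<open>d = n m - 1 - u\<close> of hyperplanes is at least this dimension, and a cone
  meets as many generic linear hyperplanes as its dimension only in \<open>0\<close>
  (\<open>generic_hyperplanes_miss_row_rank_le\<close>). This is a parameter count. Up to scaling, a nonzero \<open>N\<close> of
  rank \<open>s \<le> r\<close> is given by \<open>s (n + m - s) - 1\<close> numbers in one of finitely many charts. In each chart
  some entry of \<open>N\<close> is 1, so each equation \<open>pairing (A i) N = 0\<close> expresses one entry of \<open>A i\<close> through
  the others and \<open>N\<close>. Hence the tuples \<open>A\<close> whose hyperplanes all contain such an \<open>N\<close> are the values of
  a polynomial map from fewer than \<open>d n m\<close> parameters into a space of dimension \<open>d n m\<close>. Counting
  monomials of bounded degree shows that some nonzero polynomial vanishes on all values of such a map
  (\<open>fewer_parameters_imp_polynomial_relation\<close>), and the product over the charts of these polynomials is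
  nonzero (\<open>for_generic_hyperplanes_conj\<close>).
\<close>

section \<open>Linear dependence of families\<close>

lemma (in vector_space) family_dependent:
  assumes "finite Q" "finite T" "card T < card Q" and span: "\<And>q. q \<in> Q \<Longrightarrow> \<phi> q \<in> span T"
  obtains c where "\<exists>q\<in>Q. c q \<noteq> 0" "(\<Sum>q\<in>Q. scale (c q) (\<phi> q)) = 0"
proof (cases "inj_on \<phi> Q")
  case True
  have "dependent (\<phi> ` Q)"
    using independent_span_bound[OF \<open>finite T\<close>, of "\<phi> ` Q"] span assms(3) card_image[OF True]
    by fastforce
  then obtain u where u: "\<exists>v\<in>\<phi> ` Q. u v \<noteq> 0" "(\<Sum>v\<in>\<phi> ` Q. scale (u v) v) = 0"
    using dependent_finite[of "\<phi> ` Q"] \<open>finite Q\<close> by blast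
  show ?thesis
    by (rule that[of "u \<circ> \<phi>"]) (use u in \<open>auto simp: sum.reindex[OF True]\<close>)
next
  case False
  then obtain p q where pq: "p \<in> Q" "q \<in> Q" "p \<noteq> q" "\<phi> p = \<phi> q"
    unfolding inj_on_def by blast
  define c :: "_ \<Rightarrow> 'a" where "c x = (if x = p then 1 else if x = q then - 1 else 0)" for x
  have "(\<Sum>x\<in>Q. scale (c x) (\<phi> x)) = (\<Sum>x\<in>{p, q}. scale (c x) (\<phi> x))"
    by (rule sum.mono_neutral_right) (use pq \<open>finite Q\<close> in \<open>auto simp: c_def\<close>)
  also have "\<dots> = 0"
    using pq by (simp add: c_def)
  finally show ?thesis
    using that[of c] pq(1) by (force simp: c_def)
qed

section \<open>Polynomial functions\<close>

lemma polynomials_in_sum: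
  assumes "\<And>x. x \<in> T \<Longrightarrow> f x \<in> polynomials_in C"
  shows "(\<lambda>s. \<Sum>x\<in>T. f x s) \<in> polynomials_in C"
  using assms
  by (induction T rule: infinite_finite_induct) (auto intro: polynomials_in.const polynomials_in.add)

lemma polynomials_in_prod:
  assumes "\<And>x. x \<in> T \<Longrightarrow> f x \<in> polynomials_in C"
  shows "(\<lambda>s. \<Prod>x\<in>T. f x s) \<in> polynomials_in C"
  using assms
  by (induction T rule: infinite_finite_induct) (auto intro: polynomials_in.const polynomials_in.mult)

lemma polynomials_in_power:
  assumes "f \<in> polynomials_in C"
  shows "(\<lambda>s. f s ^ k) \<in> polynomials_in C"
  by (induction k) (auto intro: polynomials_in.const polynomials_in.mult assms)

lemma polynomials_in_uminus:
  assumes "f \<in> polynomials_in C"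
  shows "(\<lambda>s. - f s) \<in> polynomials_in C"
  using polynomials_in.mult[OF polynomials_in.const[of "-1"] assms] by simp

text \<open>
  Substitution of polynomials \<open>h\<close> into a polynomial. It is stated through the generators, so that it
  also covers a change of the type that carries the coordinates.
\<close>

lemma polynomials_in_compose:
  assumes "f \<in> polynomials_in C" and "\<And>g. g \<in> C \<Longrightarrow> (\<lambda>s. g (h s)) \<in> polynomials_in D"
  shows "(\<lambda>s. f (h s)) \<in> polynomials_in D"
  using assms(1) by induction (auto intro: assms(2) polynomials_in.intros)

lemma polynomials_in_cong:
  assumes "f \<in> polynomials_in C" and "\<And>g. g \<in> C \<Longrightarrow> g x = g y"
  shows "f x = f y"
  using assms(1) by induction (auto intro: assms(2))

definition fun_scale :: "complex \<Rightarrow> ('s \<Rightarrow> complex) \<Rightarrow> 's \<Rightarrow> complex" where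
  "fun_scale c f = (\<lambda>s. c * f s)"

interpretation cfun: vector_space "fun_scale :: complex \<Rightarrow> ('s \<Rightarrow> complex) \<Rightarrow> 's \<Rightarrow> complex"
  by unfold_locales (auto simp: fun_scale_def fun_eq_iff algebra_simps)

definition monomial :: "'v set \<Rightarrow> ('v \<Rightarrow> nat) \<Rightarrow> ('v \<Rightarrow> complex) \<Rightarrow> complex" where
  "monomial V k p = (\<Prod>v\<in>V. p v ^ k v)"

text \<open>
  The total degree is bounded, since substitution and products are additive in it. The number of these
  monomials is estimated by allowing each exponent to be as large as the degree.
\<close>

definition monomials_upto :: "'v set \<Rightarrow> nat \<Rightarrow> (('v \<Rightarrow> complex) \<Rightarrow> complex) set" where
  "monomials_upto V e = {monomial V k | k. sum k V \<le> e}"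

lemma monomials_upto_finite_card:
  assumes "finite V"
  shows "finite (monomials_upto V e) \<and> card (monomials_upto V e) \<le> (e + 1) ^ card V"
proof -
  have fin: "finite (V \<rightarrow>\<^sub>E {..e})"
    using assms by (intro finite_PiE) auto
  have sub: "monomials_upto V e \<subseteq> monomial V ` (V \<rightarrow>\<^sub>E {..e})"
  proof
    fix f assume "f \<in> monomials_upto V e"
    then obtain k where k: "f = monomial V k" "sum k V \<le> e"
      by (auto simp: monomials_upto_def)
    have "k v \<le> e" if "v \<in> V" for v
      using member_le_sum[of v V k] that k(2) assms by auto
    then have "restrict k V \<in> V \<rightarrow>\<^sub>E {..e}" by auto
    moreover have "f = monomial V (restrict k V)"
      by (simp add: k(1) monomial_def fun_eq_iff)
    ultimately show "f \<in> monomial V ` (V \<rightarrow>\<^sub>E {..e})" by blast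
  qed
  have "card (monomials_upto V e) \<le> card (V \<rightarrow>\<^sub>E {..e})"
    using card_mono[OF _ sub] card_image_le[OF fin, of "monomial V"] fin by fastforce
  also have "\<dots> = (e + 1) ^ card V"
    using assms by (simp add: card_PiE)
  finally show ?thesis
    using finite_subset[OF sub] fin by auto
qed

lemma span_monomials_upto_mono:
  assumes "d \<le> e" "f \<in> cfun.span (monomials_upto V d)"
  shows "f \<in> cfun.span (monomials_upto V e)"
proof -
  have "monomials_upto V d \<subseteq> monomials_upto V e"
    using assms(1) unfolding monomials_upto_def by fastforce
  then show ?thesis
    using cfun.span_mono assms(2) by blast
qed

text \<open>
  For a fixed factor, the functions whose product with it lies in the target form a subspace, so it is
  enough to multiply monomials, first in one argument and then in the other.
\<close>

lemma span_monomials_upto_mult: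
  assumes f: "f \<in> cfun.span (monomials_upto V d)" and g: "g \<in> cfun.span (monomials_upto V e)"
  shows "(\<lambda>p. f p * g p) \<in> cfun.span (monomials_upto V (d + e))"
proof -
  let ?S = "cfun.span (monomials_upto V (d + e))"
  have lin: "cfun.subspace {h. (\<lambda>p. a p * h p) \<in> ?S}" for a
  proof -
    have "(\<lambda>p. a p * (x + y) p) \<in> ?S" if "(\<lambda>p. a p * x p) \<in> ?S" "(\<lambda>p. a p * y p) \<in> ?S" for x y
      using cfun.span_add[OF that] by (simp add: plus_fun_def algebra_simps)
    moreover have "(\<lambda>p. a p * fun_scale c x p) \<in> ?S" if "(\<lambda>p. a p * x p) \<in> ?S" for c x
      using cfun.span_scale[OF that, of c] by (simp add: fun_scale_def algebra_simps)
    moreover have "(\<lambda>p. a p * 0 p) \<in> ?S"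
      using cfun.span_zero[of "monomials_upto V (d + e)"] by (simp add: zero_fun_def)
    ultimately show ?thesis
      by (auto simp: cfun.subspace_def)
  qed
  have mono: "(\<lambda>p. monomial V l p * monomial V k p) \<in> ?S"
    if "sum k V \<le> d" "sum l V \<le> e" for k l
  proof -
    have "(\<lambda>p. monomial V l p * monomial V k p) = monomial V (\<lambda>v. k v + l v)"
      by (simp add: monomial_def fun_eq_iff power_add prod.distrib mult.commute)
    then show ?thesis
      using that by (intro cfun.span_base) (force simp: monomials_upto_def sum.distrib)
  qed
  have "(\<lambda>p. monomial V l p * f p) \<in> ?S" if "sum l V \<le> e" for l
    using f
  proof (rule cfun.span_induct[OF _ lin])
    show "(\<lambda>p. monomial V l p * x p) \<in> ?S" if "x \<in> monomials_upto V d" for x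
      using mono \<open>sum l V \<le> e\<close> that unfolding monomials_upto_def by blast
  qed
  then have "(\<lambda>p. f p * x p) \<in> ?S" if "x \<in> monomials_upto V e" for x
    using that by (auto simp: monomials_upto_def mult.commute)
  then show ?thesis
    by (rule cfun.span_induct[OF g lin])
qed

lemma monomial_zero: "monomial V (\<lambda>_. 0) = (\<lambda>_. 1)"
  by (simp add: monomial_def fun_eq_iff)

lemma const_in_span_monomials: "(\<lambda>_. c) \<in> cfun.span (monomials_upto V e)"
proof -
  have "monomial V (\<lambda>_. 0) \<in> cfun.span (monomials_upto V e)"
    by (intro cfun.span_base) (auto simp: monomials_upto_def intro!: exI[of _ "\<lambda>_. 0"])
  from cfun.span_scale[OF this, of c] show ?thesis
    by (simp add: monomial_zero fun_scale_def)
qed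

lemma polynomials_in_has_degree:
  assumes "finite V" "f \<in> polynomials_in {\<lambda>p. p v | v. v \<in> V}"
  shows "\<exists>e. f \<in> cfun.span (monomials_upto V e)"
  using assms(2)
proof induction
  case (coord f)
  then obtain v where v: "v \<in> V" "f = (\<lambda>p. p v)" by blast
  have "f = monomial V (\<lambda>w. if w = v then 1 else 0)"
    using v assms(1)
    by (simp add: monomial_def fun_eq_iff if_distrib[of "power _"] prod.delta cong: if_cong)
  moreover have "sum (\<lambda>w. if w = v then 1 else 0 :: nat) V \<le> 1"
    using assms(1) by simp
  ultimately have "f \<in> monomials_upto V 1"
    unfolding monomials_upto_def by blast
  then show ?case
    using cfun.span_base by blast
next
  case (const c)
  then show ?case using const_in_span_monomials by blast
next
  case (add f g)
  then obtain d e where "f \<in> cfun.span (monomials_upto V d)" "g \<in> cfun.span (monomials_upto V e)"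
    by blast
  then have "f \<in> cfun.span (monomials_upto V (max d e))" "g \<in> cfun.span (monomials_upto V (max d e))"
    using span_monomials_upto_mono max.cobounded1 max.cobounded2 by metis+
  from cfun.span_add[OF this] show ?case
    unfolding plus_fun_def by blast
next
  case (mult f g)
  then show ?case using span_monomials_upto_mult by blast
qed

lemma span_monomials_upto_power:
  assumes "f \<in> cfun.span (monomials_upto V e)"
  shows "(\<lambda>p. f p ^ k) \<in> cfun.span (monomials_upto V (k * e))"
proof (induction k)
  case 0
  then show ?case by (simp add: const_in_span_monomials)
next
  case (Suc k)
  from span_monomials_upto_mult[OF assms this] show ?case by simp
qed

lemma span_monomials_upto_prod:
  assumes "finite T" "\<And>i. i \<in> T \<Longrightarrow> f i \<in> cfun.span (monomials_upto V (e i))"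
  shows "(\<lambda>p. \<Prod>i\<in>T. f i p) \<in> cfun.span (monomials_upto V (sum e T))"
  using assms
proof (induction T)
  case empty
  then show ?case by (simp add: const_in_span_monomials)
next
  case (insert i T)
  have "(\<lambda>p. f i p * (\<Prod>i\<in>T. f i p)) \<in> cfun.span (monomials_upto V (e i + sum e T))"
    by (intro span_monomials_upto_mult insert) auto
  then show ?case using insert.hyps by simp
qed

lemma sum_digits:
  fixes B :: nat
  assumes "q < B ^ n"
  shows "(\<Sum>j<n. B ^ j * (q div B ^ j mod B)) = q"
proof -
  have "(\<Sum>j<n. B ^ j * (q div B ^ j mod B)) = q mod B ^ n"
  proof (induction n)
    case (Suc n)
    then show ?case
      by (simp add: mod_mult2_eq mult.commute[of B] del: mod_mult_self1)
  qed simp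
  then show ?thesis using assms by simp
qed

lemma sum_fun_apply: "(\<Sum>q\<in>Q. f q) s = (\<Sum>q\<in>Q. f q s)" for f :: "'q \<Rightarrow> 's \<Rightarrow> complex"
  by (induction Q rule: infinite_finite_induct) auto

text \<open>
  The \<open>B ^ n\<close> monomials in \<open>n\<close> unknowns with all exponents below \<open>B\<close> become, after substitution of
  the \<open>y i\<close>, polynomials in \<open>card V < n\<close> parameters of degree \<open>O(B)\<close>. The space of those has dimension
  \<open>O(B ^ card V)\<close>, which is less than \<open>B ^ n\<close> for large \<open>B\<close>, so some combination \<open>G\<close> of the monomials
  becomes 0. Numbering the monomials by \<open>q < B ^ n\<close>, with the base \<open>B\<close> digits of \<open>q\<close> as exponents, makes
  it easy to see that \<open>G\<close> is not the zero function: at the point with coordinates \<open>t ^ (B ^ j)\<close>, the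
  monomial number \<open>q\<close> has the value \<open>t ^ q\<close> (Kronecker substitution), and \<open>G\<close> becomes a polynomial in
  \<open>t\<close> with the same coefficients.
\<close>

lemma fewer_parameters_imp_polynomial_relation:
  fixes y :: "'i \<Rightarrow> ('v \<Rightarrow> complex) \<Rightarrow> complex"
  assumes "finite V" "finite I" "card V < card I"
    and y: "\<And>i. i \<in> I \<Longrightarrow> y i \<in> polynomials_in {\<lambda>p. p v | v. v \<in> V}"
  obtains G z where "G \<in> polynomials_in {\<lambda>z. z i | i. i \<in> I}" "G z \<noteq> 0"
    "\<And>p. G (\<lambda>i. y i p) = 0"
proof -
  define n where "n = card I"
  obtain h where h: "bij_betw h {..<n} I"
    using ex_bij_betw_nat_finite[OF \<open>finite I\<close>] unfolding n_def atLeast0LessThan by blast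
  have hI: "h j \<in> I" if "j < n" for j
    using h that by (auto simp: bij_betw_def)
  have "\<exists>deg. \<forall>i\<in>I. y i \<in> cfun.span (monomials_upto V (deg i))"
    using polynomials_in_has_degree[OF \<open>finite V\<close> y] by metis
  then obtain deg where deg: "\<And>i. i \<in> I \<Longrightarrow> y i \<in> cfun.span (monomials_upto V (deg i))" by blast
  define e where "e = sum deg I"
  \<comment> \<open>\<open>B\<close> has to satisfy \<open>(n * B * e + 1) ^ card V < B * B ^ card V\<close>; the left side is at most
    \<open>b * B ^ card V\<close>.\<close>
  define b where "b = (n * e + 1) ^ card V"
  define B where "B = b + 1"
  have e: "y i \<in> cfun.span (monomials_upto V e)" if "i \<in> I" for i
    using span_monomials_upto_mono[OF _ deg[OF that]] member_le_sum[of i I deg] that \<open>finite I\<close>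
    by (simp add: e_def)
  define M :: "nat \<Rightarrow> ('i \<Rightarrow> complex) \<Rightarrow> complex" where
    "M q z = (\<Prod>j<n. z (h j) ^ (q div B ^ j mod B))" for q z
  have M_poly: "M q \<in> polynomials_in {\<lambda>z. z i | i. i \<in> I}" for q
    unfolding M_def
    by (intro polynomials_in_prod polynomials_in_power polynomials_in.coord) (use hI in blast)
  let ?T = "monomials_upto V (n * B * e)"
  have M_span: "(\<lambda>p. M q (\<lambda>i. y i p)) \<in> cfun.span ?T" for q
  proof (rule span_monomials_upto_mono)
    show "(\<lambda>p. M q (\<lambda>i. y i p)) \<in> cfun.span (monomials_upto V (\<Sum>j<n. (q div B ^ j mod B) * e))"
      unfolding M_def
      by (intro span_monomials_upto_prod span_monomials_upto_power e hI) auto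
    have "(\<Sum>j<n. (q div B ^ j mod B) * e) \<le> (\<Sum>j<n. B * e)"
      by (intro sum_mono mult_right_mono) (auto simp: B_def less_imp_le)
    then show "(\<Sum>j<n. (q div B ^ j mod B) * e) \<le> n * B * e"
      by (simp add: mult.assoc)
  qed
  have "card ?T \<le> (n * B * e + 1) ^ card V"
    using monomials_upto_finite_card[OF \<open>finite V\<close>] by blast
  also have "\<dots> \<le> ((n * e + 1) * B) ^ card V"
    by (intro power_mono) (auto simp: B_def algebra_simps)
  also have "\<dots> = b * B ^ card V"
    by (simp only: b_def power_mult_distrib)
  also have "\<dots> < B * B ^ card V"
    by (simp add: B_def)
  also have "\<dots> = B ^ Suc (card V)"
    by simp
  also have "\<dots> \<le> B ^ n"
    using assms(3) by (intro power_increasing) (auto simp: n_def B_def)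
  finally have card_T: "card ?T < card {..<B ^ n}" by simp
  have fin_T: "finite ?T" using monomials_upto_finite_card[OF \<open>finite V\<close>] by blast
  obtain c where c: "\<exists>q\<in>{..<B ^ n}. c q \<noteq> 0"
    "(\<Sum>q<B ^ n. fun_scale (c q) (\<lambda>p. M q (\<lambda>i. y i p))) = 0"
    by (rule cfun.family_dependent[OF finite_lessThan fin_T card_T M_span])
  define G where "G z = (\<Sum>q<B ^ n. c q * M q z)" for z
  have "G \<in> polynomials_in {\<lambda>z. z i | i. i \<in> I}"
    unfolding G_def by (intro polynomials_in_sum polynomials_in.mult polynomials_in.const M_poly)
  moreover have "G (\<lambda>i. y i p) = 0" for p
    using fun_cong[OF c(2), of p] by (simp add: sum_fun_apply fun_scale_def G_def)
  moreover obtain z where "G z \<noteq> 0"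
  proof -
    have "0 < B ^ n" by (simp add: B_def)
    then obtain N where N: "B ^ n = Suc N" using gr0_implies_Suc by blast
    obtain t where t: "(\<Sum>q<B ^ n. c q * t ^ q) \<noteq> 0"
      using c(1) zero_polynom_imp_zero_coeffs[of c N] unfolding N lessThan_Suc_atMost by auto
    define z where "z i = t ^ (B ^ inv_into {..<n} h i)" for i
    have "M q z = t ^ q" if "q < B ^ n" for q
    proof -
      have "M q z = (\<Prod>j<n. t ^ (B ^ j * (q div B ^ j mod B)))"
        unfolding M_def z_def
        by (intro prod.cong refl)
          (use h in \<open>simp add: bij_betw_def inv_into_f_f flip: power_mult\<close>)
      also have "\<dots> = t ^ q"
        by (simp add: sum_digits[OF that] flip: power_sum)
      finally show ?thesis .
    qed
    then have "G z = (\<Sum>q<B ^ n. c q * t ^ q)" by (simp add: G_def)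
    then show ?thesis using t that by metis
  qed
  ultimately show ?thesis using that by blast
qed

section \<open>Generic tuples of hyperplanes\<close>

lemma for_generic_hyperplanesI:
  assumes "f \<in> polynomials_in {\<lambda>A. A i $ a $ b | i a b. i < d}" "f A0 \<noteq> 0"
    and "\<And>A. f A \<noteq> 0 \<Longrightarrow> P A"
  shows "for_generic_hyperplanes d P"
  unfolding for_generic_hyperplanes_def zariski_closed_tuples_def
  by (rule exI[of _ "{A. f A = 0}"]) (use assms in \<open>auto intro!: exI[of _ "{f}"]\<close>)

text \<open>
  A proper Zariski closed set lies in the zero set of a single nonzero polynomial.
\<close>

lemma for_generic_hyperplanesE:
  assumes "for_generic_hyperplanes d P"
  obtains f A0 where "f \<in> polynomials_in {\<lambda>A. A i $ a $ b | i a b. i < d}" "f A0 \<noteq> 0"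
    "\<And>A. \<forall>i<d. A i \<noteq> 0 \<Longrightarrow> f A \<noteq> 0 \<Longrightarrow> P A"
proof -
  obtain F where F: "F \<subseteq> polynomials_in {\<lambda>A. A i $ a $ b | i a b. i < d}"
    "{A. \<forall>f\<in>F. f A = 0} \<noteq> UNIV"
    "\<And>A. \<forall>i<d. A i \<noteq> 0 \<Longrightarrow> A \<notin> {A. \<forall>f\<in>F. f A = 0} \<Longrightarrow> P A"
    using assms unfolding for_generic_hyperplanes_def zariski_closed_tuples_def by auto
  from F(2) obtain f A0 where "f \<in> F" "f A0 \<noteq> 0" by blast
  then show ?thesis using that[of f A0] F(1,3) by blast
qed

lemma polynomial_on_line:
  fixes x y :: "nat \<Rightarrow> complex^'n^'m"
  assumes "f \<in> polynomials_in {\<lambda>A. A i $ a $ b | i a b. i < d}"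
  obtains p where "\<And>t. f (\<lambda>i. x i + cscale t (y i - x i)) = poly p t"
proof -
  have "\<exists>p. \<forall>t. f (\<lambda>i. x i + cscale t (y i - x i)) = poly p t"
    using assms
  proof induction
    case (coord f)
    then obtain i a b where "f = (\<lambda>A. A i $ a $ b)" by blast
    then show ?case
      by (intro exI[of _ "[:x i $ a $ b, y i $ a $ b - x i $ a $ b:]"])
        (simp add: cscale_def algebra_simps)
  next
    case (const c)
    show ?case by (intro exI[of _ "[:c:]"]) simp
  next
    case (add f g)
    then show ?case by (metis poly_add)
  next
    case (mult f g)
    then show ?case by (metis poly_mult)
  qed
  then show ?thesis using that by blast
qed

text \<open>
  The product of two nonzero polynomial functions is nonzero: on the line through a point where the
  first does not vanish and a point where the second does not, both restrict to nonzero polynomials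
  in one variable.
\<close>

lemma for_generic_hyperplanes_conj:
  fixes P Q :: "(nat \<Rightarrow> complex^'n^'m) \<Rightarrow> bool"
  assumes "for_generic_hyperplanes d P" "for_generic_hyperplanes d Q"
  shows "for_generic_hyperplanes d (\<lambda>A. P A \<and> Q A)"
proof -
  obtain f x where f: "f \<in> polynomials_in {\<lambda>A. A i $ a $ b | i a b. i < d}" "f x \<noteq> 0"
    and P: "\<And>A. \<forall>i<d. A i \<noteq> 0 \<Longrightarrow> f A \<noteq> 0 \<Longrightarrow> P A"
    using assms(1) by (rule for_generic_hyperplanesE) blast
  obtain g y where g: "g \<in> polynomials_in {\<lambda>A. A i $ a $ b | i a b. i < d}" "g y \<noteq> 0"
    and Q: "\<And>A. \<forall>i<d. A i \<noteq> 0 \<Longrightarrow> g A \<noteq> 0 \<Longrightarrow> Q A"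
    using assms(2) by (rule for_generic_hyperplanesE) blast
  obtain p where p: "\<And>t. f (\<lambda>i. x i + cscale t (y i - x i)) = poly p t"
    using polynomial_on_line[OF f(1)] by metis
  obtain q where q: "\<And>t. g (\<lambda>i. x i + cscale t (y i - x i)) = poly q t"
    using polynomial_on_line[OF g(1)] by metis
  have ends: "(\<lambda>i. x i + cscale 0 (y i - x i)) = x" "(\<lambda>i. x i + cscale 1 (y i - x i)) = y"
    by (simp_all add: cscale_def vec_eq_iff fun_eq_iff)
  have "p \<noteq> 0" "q \<noteq> 0"
    using p[of 0] q[of 1] f(2) g(2) ends by auto
  then obtain t where "poly (p * q) t \<noteq> 0"
    using poly_all_0_iff_0[of "p * q"] by auto
  then have "f (\<lambda>i. x i + cscale t (y i - x i)) * g (\<lambda>i. x i + cscale t (y i - x i)) \<noteq> 0"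
    by (simp add: p q)
  moreover have "(\<lambda>A. f A * g A) \<in> polynomials_in {\<lambda>A. A i $ a $ b | i a b. i < d}"
    by (intro polynomials_in.mult f g)
  ultimately show ?thesis
    unfolding for_generic_hyperplanes_def zariski_closed_tuples_def
    by (intro exI[of _ "{A. f A * g A = 0}"] conjI exI[of _ "{\<lambda>A. f A * g A}"])
      (use P Q in auto)
qed

lemma for_generic_hyperplanes_mono:
  assumes "for_generic_hyperplanes d P" "\<And>A. P A \<Longrightarrow> Q A"
  shows "for_generic_hyperplanes d Q"
  using assms unfolding for_generic_hyperplanes_def by blast

lemma for_generic_hyperplanes_True:
  "for_generic_hyperplanes d (\<lambda>_ :: nat \<Rightarrow> complex^'n^'m. True)"
  by (rule for_generic_hyperplanesI[OF polynomials_in.const[of 1]]) auto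

lemma for_generic_hyperplanes_ball:
  fixes P :: "'x \<Rightarrow> (nat \<Rightarrow> complex^'n^'m) \<Rightarrow> bool"
  assumes "finite X" "\<And>x. x \<in> X \<Longrightarrow> for_generic_hyperplanes d (P x)"
  shows "for_generic_hyperplanes d (\<lambda>A. \<forall>x\<in>X. P x A)"
  using assms
proof (induction X)
  case empty
  then show ?case by (simp add: for_generic_hyperplanes_True)
next
  case (insert x X)
  then show ?case by (simp add: for_generic_hyperplanes_conj)
qed

section \<open>Matrices of bounded rank\<close>

text \<open>
  Any \<open>r + 1\<close> rows are dependent as a family. Compared with the dimension of the span of the set of
  rows, this form makes it visible that the condition is closed, and it allows repeated rows.
\<close>

definition row_rank_le :: "nat \<Rightarrow> complex^'n^'m \<Rightarrow> bool" where
  "row_rank_le r N \<longleftrightarrow>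
     (\<forall>I. card I = Suc r \<longrightarrow> (\<exists>c. c \<noteq> 0 \<and> (\<forall>i. i \<notin> I \<longrightarrow> c $ i = 0) \<and> c v* N = 0))"

lemma vector_matrix_mult_nth: "(c v* N) $ b = (\<Sum>i\<in>UNIV. N $ i $ b * c $ i)"
  for N :: "complex^'n^'m"
  by (simp add: vector_matrix_mult_def mult.commute)

lemma row_rank_le_cscale:
  assumes "row_rank_le r N"
  shows "row_rank_le r (cscale k N)"
proof -
  have "c v* cscale k N = k *s (c v* N)" for c
    by (simp add: vec_eq_iff vector_matrix_mult_nth cscale_def sum_distrib_left mult.assoc)
  then show ?thesis
    using assms unfolding row_rank_le_def by (metis vec.scale_zero_right)
qed

text \<open>
  The coefficients of a dependence can be normalised to norm 1, and then they range over a compact set;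
  a projection along a compact factor maps closed sets to closed sets.
\<close>

lemma closed_row_rank_le: "closed {N :: complex^'n^'m. row_rank_le r N}"
proof -
  define K :: "'m set \<Rightarrow> (complex^'m) set" where
    "K I = sphere 0 1 \<inter> {c. \<forall>i. i \<notin> I \<longrightarrow> c $ i = 0}" for I
  have K: "compact (K I)" for I
  proof -
    have "closed {c :: complex^'m. \<forall>i. i \<notin> I \<longrightarrow> c $ i = 0}"
      by (intro closed_Collect_all closed_Collect_imp open_Collect_const closed_Collect_eq
          continuous_intros)
    then show ?thesis unfolding K_def by (intro compact_Int_closed) auto
  qed
  have "continuous_on UNIV (\<lambda>x :: (complex^'m) \<times> (complex^'n^'m). fst x v* snd x)"
    unfolding vector_matrix_mult_def by (intro continuous_intros)
  then have "closed {x :: (complex^'m) \<times> (complex^'n^'m). fst x v* snd x = 0}"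
    by (intro closed_Collect_eq continuous_on_const)
  from closed_compact_projection[OF K this]
  have closed: "closed {N :: complex^'n^'m. \<exists>c\<in>K I. c v* N = 0}" for I
    by (simp add: Bex_def)
  have "row_rank_le r N \<longleftrightarrow> (\<forall>I. card I = Suc r \<longrightarrow> (\<exists>c\<in>K I. c v* N = 0))" for N :: "complex^'n^'m"
  proof -
    have "(\<exists>c. c \<noteq> 0 \<and> (\<forall>i. i \<notin> I \<longrightarrow> c $ i = 0) \<and> c v* N = 0) \<longleftrightarrow> (\<exists>c\<in>K I. c v* N = 0)" for I
    proof
      assume "\<exists>c. c \<noteq> 0 \<and> (\<forall>i. i \<notin> I \<longrightarrow> c $ i = 0) \<and> c v* N = 0"
      then obtain c where c: "c \<noteq> 0" "\<forall>i. i \<notin> I \<longrightarrow> c $ i = 0" "c v* N = 0" by blast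
      have "(c /\<^sub>R norm c) v* N = (c v* N) /\<^sub>R norm c"
        by (simp add: vec_eq_iff vector_matrix_mult_nth scaleR_sum_right)
      then have "(c /\<^sub>R norm c) v* N = 0" using c by simp
      moreover have "c /\<^sub>R norm c \<in> K I"
        using c by (simp add: K_def)
      ultimately show "\<exists>c\<in>K I. c v* N = 0" by blast
    next
      assume "\<exists>c\<in>K I. c v* N = 0"
      then obtain c where "c \<in> K I" "c v* N = 0" by blast
      then show "\<exists>c. c \<noteq> 0 \<and> (\<forall>i. i \<notin> I \<longrightarrow> c $ i = 0) \<and> c v* N = 0"
        by (intro exI[of _ c]) (auto simp: K_def)
    qed
    then show ?thesis by (simp add: row_rank_le_def)
  qed
  then show ?thesis
    by (auto intro!: closed_Collect_all closed_Collect_imp open_Collect_const closed)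
qed

lemma row_rank_leI:
  fixes N :: "complex^'n^'m"
  assumes "\<And>a. N $ a \<in> W" "vec.dim W \<le> r"
  shows "row_rank_le r N"
  unfolding row_rank_le_def
proof (intro allI impI)
  fix I :: "'m set" assume I: "card I = Suc r"
  obtain B where B: "B \<subseteq> W" "vec.independent B" "W \<subseteq> vec.span B" "card B = vec.dim W"
    by (rule vec.basis_exists)
  have "finite B" using B(2) vec.finiteI_independent by blast
  moreover have "card B < card I" using B(4) I assms(2) by simp
  moreover have "N $ i \<in> vec.span B" for i
    using assms(1) B(3) by blast
  ultimately obtain c where c: "\<exists>i\<in>I. c i \<noteq> 0" "(\<Sum>i\<in>I. c i *s N $ i) = 0"
    by (rule vec.family_dependent[OF finite[of I]])
  define c' where "c' = (\<chi> i. if i \<in> I then c i else 0)"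
  have "(c' v* N) $ b = 0" for b
  proof -
    have "(c' v* N) $ b = (\<Sum>i\<in>I. N $ i $ b * c i)"
      unfolding vector_matrix_mult_nth c'_def
      by (rule sum.mono_neutral_cong_right) auto
    also have "\<dots> = (\<Sum>i\<in>I. c i *s N $ i) $ b"
      by (simp add: mult.commute)
    finally show ?thesis using c(2) by simp
  qed
  then have "c' v* N = 0" by (simp add: vec_eq_iff)
  moreover have "c' \<noteq> 0" using c(1) by (auto simp: c'_def vec_eq_iff)
  ultimately show "\<exists>c. c \<noteq> 0 \<and> (\<forall>i. i \<notin> I \<longrightarrow> c $ i = 0) \<and> c v* N = 0"
    by (intro exI[of _ c']) (auto simp: c'_def)
qed

text \<open>
  A maximal independent set \<open>J\<close> of rows spans all rows. For fixed \<open>J\<close>, the matrix is determined by its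
  rows in \<open>J\<close> and the coefficients \<open>C\<close>; a nonzero entry at \<open>(a0, b0)\<close> is to be scaled to 1 later.
\<close>

lemma row_rank_le_chart:
  fixes N :: "complex^'n^'m"
  assumes "row_rank_le r N" "N \<noteq> 0"
  obtains J a0 b0 C where "card J \<le> r" "a0 \<in> J" "N $ a0 $ b0 \<noteq> 0"
    "\<And>a b. a \<notin> J \<Longrightarrow> N $ a $ b = (\<Sum>j\<in>J. C a j * N $ j $ b)"
proof -
  define indep where
    "indep J \<longleftrightarrow> (\<forall>c. (\<forall>i. i \<notin> J \<longrightarrow> c $ i = 0) \<longrightarrow> c v* N = 0 \<longrightarrow> c = 0)" for J
  have "indep {}" by (simp add: indep_def vec_eq_iff)
  moreover have "finite {J. indep J}" by simp
  ultimately obtain J where J: "indep J" and max: "\<And>J'. indep J' \<Longrightarrow> J \<subseteq> J' \<Longrightarrow> J = J'"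
    using finite_has_maximal[of "{J. indep J}"] by blast
  have "card J \<le> r"
  proof (rule ccontr)
    assume "\<not> card J \<le> r"
    then obtain I where "I \<subseteq> J" "card I = Suc r"
      using obtain_subset_with_card_n[of "Suc r" J] by (metis not_less_eq_eq)
    then show False
      using assms(1) J unfolding row_rank_le_def indep_def by blast
  qed
  have "\<exists>C. \<forall>b. N $ a $ b = (\<Sum>j\<in>J. C j * N $ j $ b)" if "a \<notin> J" for a
  proof -
    have "\<not> indep (insert a J)" using max[of "insert a J"] that by blast
    then obtain c where c: "\<And>i. i \<noteq> a \<Longrightarrow> i \<notin> J \<Longrightarrow> c $ i = 0" "c v* N = 0" "c \<noteq> 0"
      by (auto simp: indep_def)
    have ca: "c $ a \<noteq> 0"
      using J c unfolding indep_def by metis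
    have "N $ a $ b = (\<Sum>j\<in>J. (- c $ j / c $ a) * N $ j $ b)" for b
    proof -
      have "0 = (\<Sum>i\<in>UNIV. N $ i $ b * c $ i)"
        using c(2) vector_matrix_mult_nth[of c N b] by simp
      also have "\<dots> = (\<Sum>i\<in>insert a J. N $ i $ b * c $ i)"
        by (rule sum.mono_neutral_right) (use c(1) in auto)
      also have "\<dots> = N $ a $ b * c $ a + (\<Sum>j\<in>J. N $ j $ b * c $ j)"
        using that by simp
      finally have "N $ a $ b = - (\<Sum>j\<in>J. N $ j $ b * c $ j) / c $ a"
        using ca by (simp add: field_simps eq_neg_iff_add_eq_0)
      then show ?thesis
        by (simp add: sum_divide_distrib sum_negf mult.commute)
    qed
    then show ?thesis by (intro exI[of _ "\<lambda>j. - c $ j / c $ a"] allI)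
  qed
  then obtain C where C: "\<And>a b. a \<notin> J \<Longrightarrow> N $ a $ b = (\<Sum>j\<in>J. C a j * N $ j $ b)"
    by metis
  moreover have "\<exists>a0\<in>J. \<exists>b0. N $ a0 $ b0 \<noteq> 0"
  proof (rule ccontr)
    assume "\<not> ?thesis"
    then have "N $ a $ b = 0" for a b using C[of a b] by (cases "a \<in> J") auto
    then show False using \<open>N \<noteq> 0\<close> by (simp add: vec_eq_iff)
  qed
  ultimately show ?thesis using that \<open>card J \<le> r\<close> by blast
qed

text \<open>
  The parameters are the entries of \<open>A i\<close> outside of \<open>(a0, b0)\<close>, the entries of the rows in \<open>J\<close>
  of \<open>N\<close> outside of \<open>(a0, b0)\<close>, and the coefficients \<open>C\<close>. With \<open>s = card J\<close>, these are
  \<open>d (n m - 1) + (s n - 1) + (m - s) s\<close> numbers, and the hypothesis on \<open>d\<close> makes this smaller than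
  \<open>d n m\<close>. As \<open>N\<close> has the entry 1 at \<open>(a0, b0)\<close>, the remaining entry of \<open>A i\<close> is found from
  \<open>pairing (A i) N = 0\<close>, so the entries of \<open>A\<close> are polynomials in the parameters.
\<close>

lemma generic_hyperplanes_miss_chart:
  fixes J :: "'m::finite set" and a0 :: 'm and b0 :: "'n::finite"
  assumes a0: "a0 \<in> J" and d: "card J * (CARD('n) + CARD('m) - card J) \<le> d"
  shows "for_generic_hyperplanes d (\<lambda>A :: nat \<Rightarrow> complex^'n^'m.
    \<nexists>N C. N $ a0 $ b0 = 1 \<and> (\<forall>a b. a \<notin> J \<longrightarrow> N $ a $ b = (\<Sum>j\<in>J. C a j * N $ j $ b)) \<and>
      (\<forall>i<d. pairing (A i) N = 0))"
proof -
  define V :: "(nat \<times> 'm \<times> 'n + 'm \<times> 'n + 'm \<times> 'm) set" where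
    "V = ({..<d} \<times> (UNIV - {(a0, b0)})) <+> ((J \<times> UNIV - {(a0, b0)}) <+> ((- J) \<times> J))"
  define I :: "(nat \<times> 'm \<times> 'n) set" where "I = {..<d} \<times> UNIV"
  \<comment> \<open>\<open>N1\<close> gives the entries of \<open>N\<close> in the rows of \<open>J\<close>, \<open>N2\<close> all entries of \<open>N\<close>, and \<open>y\<close> the entries of
    \<open>A\<close>, each as a polynomial in the parameters.\<close>
  define N1 where "N1 a b p = (if (a, b) = (a0, b0) then 1 else p (Inr (Inl (a, b))))"
    for a b and p :: "nat \<times> 'm \<times> 'n + 'm \<times> 'n + 'm \<times> 'm \<Rightarrow> complex"
  define N2 where "N2 a b p = (if a \<in> J then N1 a b p
    else \<Sum>j\<in>J. p (Inr (Inr (a, j))) * N1 j b p)" for a b p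
  define y where "y x p = (case x of (i, ab) \<Rightarrow> if ab = (a0, b0)
    then - (\<Sum>(a, b)\<in>UNIV - {(a0, b0)}. p (Inl (i, a, b)) * N2 a b p)
    else p (Inl x))" for x :: "nat \<times> 'm \<times> 'n" and p
  let ?P = "polynomials_in {\<lambda>p. p v | v. v \<in> V}"
  have fin: "finite V" "finite I" by (auto simp: V_def I_def)
  have N1: "N1 a b \<in> ?P" if "a \<in> J" for a b
    unfolding N1_def using that
    by (cases "(a, b) = (a0, b0)")
      (auto simp: V_def intro!: polynomials_in.const polynomials_in.coord)
  have N2: "N2 a b \<in> ?P" for a b
  proof (cases "a \<in> J")
    case True
    then show ?thesis using N1 by (simp add: N2_def[abs_def])
  next
    case False
    then show ?thesis unfolding N2_def
      by (simp, intro polynomials_in_sum polynomials_in.mult polynomials_in.coord N1)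
        (auto simp: V_def)
  qed
  have y: "y x \<in> ?P" if "x \<in> I" for x
  proof -
    obtain i ab where "x = (i, ab)" by (cases x)
    with that have x: "x = (i, ab)" "i < d" by (auto simp: I_def)
    show ?thesis
    proof (cases "ab = (a0, b0)")
      case True
      then show ?thesis unfolding y_def x case_prod_beta
        by (simp, intro polynomials_in_uminus polynomials_in_sum polynomials_in.mult
            polynomials_in.coord N2) (use x in \<open>auto simp: V_def\<close>)
    next
      case False
      then show ?thesis unfolding y_def x
        by (simp, intro polynomials_in.coord) (use x in \<open>auto simp: V_def\<close>)
    qed
  qed
  have card: "card V < card I"
  proof -
    let ?n = "CARD('n)" and ?m = "CARD('m)" and ?s = "card J"
    have s: "0 < ?s" "?s \<le> ?m" using a0 by (auto simp: card_gt_0_iff card_mono)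
    have "card V = d * (?m * ?n - 1) + (?s * ?n - 1) + (?m - ?s) * ?s"
      using a0 unfolding V_def
      by (simp add: card_Plus card_Diff_subset card_cartesian_product Compl_eq_Diff_UNIV)
    moreover have "?s * ?n + (?m - ?s) * ?s \<le> d"
      using d s(2) by (simp add: diff_mult_distrib2 add_mult_distrib2 algebra_simps)
    moreover have "0 < ?s * ?n" using s(1) by simp
    moreover have "d * (?m * ?n - 1) + d = d * (?m * ?n)"
      by (simp add: diff_mult_distrib2)
    moreover have "card I = d * (?m * ?n)"
      by (simp add: I_def card_cartesian_product)
    ultimately show ?thesis
      by linarith
  qed
  obtain G z where G: "G \<in> polynomials_in {\<lambda>z. z i | i. i \<in> I}" "G z \<noteq> 0"
    "\<And>p. G (\<lambda>i. y i p) = 0"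
    by (rule fewer_parameters_imp_polynomial_relation[OF fin card y]) blast+
  define flat :: "(nat \<Rightarrow> complex^'n^'m) \<Rightarrow> nat \<times> 'm \<times> 'n \<Rightarrow> complex" where
    "flat A = (\<lambda>(i, a, b). A i $ a $ b)" for A
  show ?thesis
  proof (rule for_generic_hyperplanesI)
    show "(\<lambda>A. G (flat A)) \<in> polynomials_in {\<lambda>A. A i $ a $ b | i a b. i < d}"
      by (rule polynomials_in_compose[OF G(1)])
        (auto simp: flat_def I_def intro!: polynomials_in.coord)
    have "flat (\<lambda>i. \<chi> a b. z (i, a, b)) = z" by (simp add: flat_def fun_eq_iff)
    then show "G (flat (\<lambda>i. \<chi> a b. z (i, a, b))) \<noteq> 0" using G(2) by simp
  next
    fix A assume GA: "G (flat A) \<noteq> 0"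
    show "\<nexists>N C. N $ a0 $ b0 = 1 \<and> (\<forall>a b. a \<notin> J \<longrightarrow> N $ a $ b = (\<Sum>j\<in>J. C a j * N $ j $ b)) \<and>
      (\<forall>i<d. pairing (A i) N = 0)"
    proof
      assume "\<exists>N C. N $ a0 $ b0 = 1 \<and> (\<forall>a b. a \<notin> J \<longrightarrow> N $ a $ b = (\<Sum>j\<in>J. C a j * N $ j $ b)) \<and>
        (\<forall>i<d. pairing (A i) N = 0)"
      then obtain N C where N: "N $ a0 $ b0 = 1"
        "\<And>a b. a \<notin> J \<Longrightarrow> N $ a $ b = (\<Sum>j\<in>J. C a j * N $ j $ b)"
        "\<And>i. i < d \<Longrightarrow> pairing (A i) N = 0" by blast
      define p where "p = case_sum (flat A) (case_sum (\<lambda>(a, b). N $ a $ b) (\<lambda>(a, j). C a j))"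
      have N1: "N1 a b p = N $ a $ b" for a b
        by (auto simp: N1_def p_def N(1))
      have N2: "N2 a b p = N $ a $ b" for a b
        using N(2)[of a b] by (simp add: N2_def N1) (simp add: p_def)
      have yA: "y x p = flat A x" if x: "x \<in> I" for x
      proof -
        obtain i a b where "x = (i, a, b)" by (cases x)
        with x have x: "x = (i, a, b)" "i < d" by (auto simp: I_def)
        show ?thesis
        proof (cases "(a, b) = (a0, b0)")
          case True
          have "0 = (\<Sum>(a, b)\<in>UNIV. A i $ a $ b * N $ a $ b)"
            using N(3)[OF x(2)] by (simp add: pairing_def sum.cartesian_product)
          also have "\<dots> = A i $ a0 $ b0 + (\<Sum>(a, b)\<in>UNIV - {(a0, b0)}. A i $ a $ b * N $ a $ b)"
            by (subst sum.remove[of _ "(a0, b0)"]) (auto simp: N(1))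
          finally show ?thesis
            using True by (simp add: x(1) y_def N2) (simp add: p_def flat_def add_eq_0_iff2)
        next
          case False
          then show ?thesis by (auto simp: x(1) y_def p_def)
        qed
      qed
      have "G (flat A) = G (\<lambda>i. y i p)"
        by (rule polynomials_in_cong[OF G(1)]) (use yA in auto)
      then show False using G(3) GA by simp
    qed
  qed
qed

section \<open>The conormal space of a determinantal variety\<close>

lemma pairing_cscale: "pairing B (cscale k N) = k * pairing B N"
  by (simp add: pairing_def cscale_def sum_distrib_left algebra_simps)

text \<open>
  All tangent vectors that the argument needs are directions of real lines inside the variety.
\<close>

lemma tangent_space_line:
  assumes "\<And>t. A + t *\<^sub>R v \<in> X"
  shows "v \<in> tangent_space X A"
proof -
  have "((\<lambda>t. A + t *\<^sub>R v) has_vector_derivative v) (at 0)"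
    by (auto intro!: derivative_eq_intros)
  then show ?thesis
    unfolding tangent_space_def using assms by (auto intro!: exI[of _ "\<lambda>t. A + t *\<^sub>R v"])
qed

lemma Sigma_barI:
  assumes "W \<subseteq> {v. A *v v = 0}" "r \<le> vec.dim W"
  shows "A \<in> Sigma_bar r"
  using vec.dim_subset[OF assms(1)] assms(2) by (simp add: Sigma_bar_def)

lemma dim_coordinate_hyperplane:
  fixes K :: "(complex^'n) set"
  assumes "vec.subspace K"
  shows "vec.dim K \<le> Suc (vec.dim (K \<inter> {v. v $ b = 0}))"
proof (cases "K \<subseteq> {v. v $ b = 0}")
  case True
  then show ?thesis by (simp add: Int_absorb2)
next
  case False
  then obtain w where w: "w \<in> K" "w $ b \<noteq> 0" by blast
  have "K \<subseteq> vec.span (insert w (K \<inter> {v. v $ b = 0}))"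
  proof
    fix v assume v: "v \<in> K"
    define c where "c = v $ b / w $ b"
    have "v - c *s w \<in> K \<inter> {v. v $ b = 0}"
      using v w assms by (simp add: c_def vec.subspace_diff vec.subspace_scale)
    then show "v \<in> vec.span (insert w (K \<inter> {v. v $ b = 0}))"
      unfolding vec.span_breakdown_eq by (blast intro: vec.span_base)
  qed
  then have "vec.dim K \<le> vec.dim (insert w (K \<inter> {v. v $ b = 0}))"
    using vec.dim_subset vec.dim_span by metis
  then show ?thesis by (simp add: vec.dim_insert split: if_splits)
qed

lemma subspace_matrix_kernel: "vec.subspace {v. A *v v = 0}" for A :: "complex^'n^'m"
  by (auto simp: vec.subspace_def matrix_vector_right_distrib vector_scalar_commute)

text \<open>
  The direction \<open>v\<close> has row number \<open>c\<close> of \<open>A\<close> as its row number \<open>a\<close>, and 0 elsewhere. A vector in the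
  kernel of \<open>A\<close> is also in the kernel of \<open>v\<close>, so the line through \<open>A\<close> along \<open>v\<close> does not leave the variety.
  The pairing of \<open>N\<close> with \<open>v\<close> is the entry \<open>c\<close> of \<open>A\<close> applied to row \<open>a\<close> of \<open>N\<close>.
\<close>

lemma conormal_rows_in_kernel:
  fixes A N :: "complex^'n^'m"
  assumes "A \<in> Sigma_bar r" "tangent_space (Sigma_bar r) A \<subseteq> {v. pairing N v = 0}"
  shows "A *v (N $ a) = 0"
proof -
  have "(A *v (N $ a)) $ c = 0" for c
  proof -
    define v :: "complex^'n^'m" where "v = (\<chi> i. if i = a then A $ c else 0)"
    have "A + t *\<^sub>R v \<in> Sigma_bar r" for t
    proof (rule Sigma_barI)
      have "((A + t *\<^sub>R v) *v x) $ i = (A *v x) $ i + t *\<^sub>R (if i = a then (A *v x) $ c else 0)" for x i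
        by (simp add: matrix_vector_mult_def v_def distrib_right sum.distrib scaleR_sum_right)
      then show "{x. A *v x = 0} \<subseteq> {x. (A + t *\<^sub>R v) *v x = 0}"
        by (auto simp: vec_eq_iff[of "(A + t *\<^sub>R v) *v x" for x])
      show "r \<le> vec.dim {x. A *v x = 0}" using assms(1) by (simp add: Sigma_bar_def)
    qed
    then have "pairing N v = 0" using tangent_space_line assms(2) by blast
    moreover have "pairing N v = (\<Sum>i\<in>UNIV. if i = a then \<Sum>j\<in>UNIV. N $ a $ j * A $ c $ j else 0)"
      unfolding pairing_def v_def by (intro sum.cong) auto
    ultimately show ?thesis by (simp add: matrix_vector_mult_def mult.commute)
  qed
  then show ?thesis by (simp add: vec_eq_iff)
qed

text \<open>
  Changing the entry \<open>(a, b)\<close> does not affect the action on vectors with \<open>b\<close>-th coordinate 0, and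
  these cut the kernel down by at most one dimension. So if the kernel is larger than required, every
  entry of \<open>A\<close> can be changed freely within the variety, and only \<open>N = 0\<close> annihilates all these
  directions.
\<close>

lemma conormal_kernel_dim:
  fixes A N :: "complex^'n^'m"
  assumes "N \<noteq> 0" "tangent_space (Sigma_bar r) A \<subseteq> {v. pairing N v = 0}"
  shows "vec.dim {v. A *v v = 0} \<le> r"
proof (rule ccontr)
  assume large: "\<not> vec.dim {v. A *v v = 0} \<le> r"
  have "N $ a $ b = 0" for a b
  proof -
    define E :: "complex^'n^'m" where "E = (\<chi> i j. if i = a \<and> j = b then 1 else 0)"
    have "A + t *\<^sub>R E \<in> Sigma_bar r" for t
    proof (rule Sigma_barI)
      have "((A + t *\<^sub>R E) *v x) $ i = (A *v x) $ i + t *\<^sub>R (\<Sum>j\<in>UNIV. E $ i $ j * x $ j)" for x i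
        by (simp add: matrix_vector_mult_def distrib_right sum.distrib scaleR_sum_right)
      moreover have "(\<Sum>j\<in>UNIV. E $ i $ j * x $ j) = 0" if "x $ b = 0" for x i
        by (rule sum.neutral) (use that in \<open>auto simp: E_def\<close>)
      ultimately show "{x. A *v x = 0} \<inter> {x. x $ b = 0} \<subseteq> {x. (A + t *\<^sub>R E) *v x = 0}"
        by (auto simp: vec_eq_iff[of "(A + t *\<^sub>R E) *v x" for x])
      show "r \<le> vec.dim ({x. A *v x = 0} \<inter> {x. x $ b = 0})"
        using dim_coordinate_hyperplane[OF subspace_matrix_kernel, of A b] large by simp
    qed
    then have "pairing N E = 0" using tangent_space_line assms(2) by blast
    moreover have "pairing N E = (\<Sum>i\<in>UNIV. if i = a then \<Sum>j\<in>UNIV. if j = b then N $ a $ b else 0 else 0)"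
      unfolding pairing_def E_def by (intro sum.cong) (auto simp: if_distrib[of "(*) _"] cong: if_cong)
    ultimately show ?thesis by simp
  qed
  then show False using \<open>N \<noteq> 0\<close> by (simp add: vec_eq_iff)
qed

lemma topspace_proj_topology:
  "topspace (proj_topology :: (complex^'n^'m) set topology) = proj_space"
proof
  show "topspace proj_topology \<subseteq> (proj_space :: (complex^'n^'m) set set)"
    using openin_proj_topology openin_topspace by blast
  have "{N :: complex^'n^'m. N \<noteq> 0 \<and> cmat.span {N} \<in> proj_space} = - {0}"
    by (auto simp: proj_space_def)
  then have "openin proj_topology (proj_space :: (complex^'n^'m) set set)"
    by (simp add: openin_proj_topology open_Compl)
  then show "(proj_space :: (complex^'n^'m) set set) \<subseteq> topspace proj_topology"
    by (rule openin_subset)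
qed

lemma span_singleton_eq_imp_multiple:
  assumes "cmat.span {N} = cmat.span {N'}"
  obtains k where "N = cscale k N'"
proof -
  have "N \<in> cmat.span {N'}" using assms cmat.span_base[of N "{N}"] by auto
  then show ?thesis using that by (auto simp: cmat.span_singleton)
qed

text \<open>
  The rows of a conormal vector \<open>N\<close> at \<open>x\<close> lie in the kernel of \<open>x\<close>, of dimension at most \<open>r\<close>. The
  rank does not change along the line spanned by \<open>N\<close>, so the closed condition on matrices gives a
  closed subset of the projective space, and the bound extends to the closure.
\<close>

lemma conormal_space_row_rank_le:
  fixes A :: "complex^'n^'m"
  assumes "(A, l) \<in> conormal_space (Sigma_bar r)"
  shows "l \<in> {cmat.span {N} | N. N \<noteq> 0 \<and> row_rank_le r N}"
proof -
  let ?X = "Sigma_bar r :: (complex^'n^'m) set"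
  let ?L = "{cmat.span {N} | N :: complex^'n^'m. N \<noteq> 0 \<and> row_rank_le r N}"
  have "{N :: complex^'n^'m. N \<noteq> 0 \<and> cmat.span {N} \<in> proj_space - ?L} = - {0} \<inter> - {N. row_rank_le r N}"
  proof (intro equalityI subsetI)
    fix N :: "complex^'n^'m"
    assume N: "N \<in> - {0} \<inter> - {N. row_rank_le r N}"
    have "cmat.span {N} \<notin> ?L"
    proof
      assume "cmat.span {N} \<in> ?L"
      then obtain N' where "cmat.span {N} = cmat.span {N'}" "row_rank_le r N'" by blast
      then have "row_rank_le r N"
        by (elim span_singleton_eq_imp_multiple) (simp add: row_rank_le_cscale)
      then show False using N by simp
    qed
    then show "N \<in> {N. N \<noteq> 0 \<and> cmat.span {N} \<in> proj_space - ?L}"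
      using N by (auto simp: proj_space_def)
  qed auto
  then have "closedin proj_topology ?L"
    unfolding closedin_def topspace_proj_topology openin_proj_topology
    using closed_row_rank_le[of r] by (auto simp: proj_space_def open_Int open_Compl)
  then have "closedin (prod_topology (top_of_set ?X) proj_topology) (?X \<times> ?L)"
    by (simp add: closedin_prod_Times_iff)
  moreover have "{(x, cmat.span {N}) | x N. smooth_point ?X x \<and> N \<noteq> 0 \<and>
      tangent_space ?X x \<subseteq> {v. pairing N v = 0}} \<subseteq> ?X \<times> ?L"
  proof
    fix z
    assume "z \<in> {(x, cmat.span {N}) | x N. smooth_point ?X x \<and> N \<noteq> 0 \<and>
      tangent_space ?X x \<subseteq> {v. pairing N v = 0}}"
    then obtain x N where z: "z = (x, cmat.span {N})" and "smooth_point ?X x"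
      and N: "N \<noteq> 0" "tangent_space ?X x \<subseteq> {v. pairing N v = 0}" by blast
    then have x: "x \<in> ?X" by (simp add: smooth_point_def)
    have "row_rank_le r N"
      using conormal_rows_in_kernel[OF x N(2)] conormal_kernel_dim[OF N]
      by (intro row_rank_leI[where W = "{v. x *v v = 0}"]) auto
    then show "z \<in> ?X \<times> ?L"
      using x z N(1) by blast
  qed
  ultimately have "conormal_space ?X \<subseteq> ?X \<times> ?L"
    unfolding conormal_space_def by (rule closure_of_minimal[rotated])
  then show ?thesis using assms by blast
qed

section \<open>Emptiness of the polar varieties\<close>

text \<open>
  There are finitely many charts, and the largest number of parameters occurs for \<open>card J = r\<close>:
  \<open>s (n + m - s)\<close> increases with \<open>s\<close> in the range \<open>s \<le> r \<le> min n m\<close>.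
\<close>

lemma generic_hyperplanes_miss_row_rank_le:
  assumes r: "r \<le> CARD('n::finite)" "r \<le> CARD('m::finite)"
    and d: "r * (CARD('n) + CARD('m) - r) \<le> d"
  shows "for_generic_hyperplanes d (\<lambda>A :: nat \<Rightarrow> complex^'n^'m.
    \<forall>N. row_rank_le r N \<longrightarrow> (\<forall>i<d. pairing (A i) N = 0) \<longrightarrow> N = 0)"
proof -
  define avoid where "avoid = (\<lambda>(J, a0, b0) (A :: nat \<Rightarrow> complex^'n^'m).
    \<nexists>N C. N $ a0 $ b0 = 1 \<and> (\<forall>a b. a \<notin> J \<longrightarrow> N $ a $ b = (\<Sum>j\<in>J. C a j * N $ j $ b)) \<and>
      (\<forall>i<d. pairing (A i) N = 0))"
  let ?X = "{(J :: 'm set, a0 :: 'm, b0 :: 'n). a0 \<in> J \<and> card J \<le> r}"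
  have avoid: "for_generic_hyperplanes d (\<lambda>A. \<forall>x\<in>?X. avoid x A)"
  proof (rule for_generic_hyperplanes_ball)
    fix x assume "x \<in> ?X"
    then obtain J a0 b0 where x: "x = (J, a0, b0)" "a0 \<in> J" "card J \<le> r" by blast
    \<comment> \<open>The product is \<open>r (n + m - r) - s (n + m - s)\<close> for \<open>s = card J\<close>.\<close>
    have "0 \<le> (int r - int (card J)) * (int CARD('n) + int CARD('m) - int r - int (card J))"
      using r x(3) by (intro mult_nonneg_nonneg) auto
    then have "int (card J) * (int CARD('n) + int CARD('m) - int (card J))
        \<le> int r * (int CARD('n) + int CARD('m) - int r)"
      by (simp add: algebra_simps)
    then have "int (card J * (CARD('n) + CARD('m) - card J)) \<le> int (r * (CARD('n) + CARD('m) - r))"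
      using r x(3) by (simp add: of_nat_diff)
    then have "card J * (CARD('n) + CARD('m) - card J) \<le> d" using d by linarith
    then show "for_generic_hyperplanes d (avoid x)"
      using generic_hyperplanes_miss_chart[OF x(2)] by (simp add: avoid_def x(1))
  qed simp
  show ?thesis
  proof (rule for_generic_hyperplanes_mono[OF avoid], intro allI impI)
    fix A :: "nat \<Rightarrow> complex^'n^'m" and N
    assume A: "\<forall>x\<in>?X. avoid x A" and N: "row_rank_le r N" "\<forall>i<d. pairing (A i) N = 0"
    show "N = 0"
    proof (rule ccontr)
      assume "N \<noteq> 0"
      with N(1) obtain J a0 b0 C where J: "card J \<le> r" "a0 \<in> J" "N $ a0 $ b0 \<noteq> 0"
        and C: "\<And>a b. a \<notin> J \<Longrightarrow> N $ a $ b = (\<Sum>j\<in>J. C a j * N $ j $ b)"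
        by (rule row_rank_le_chart) blast
      define M where "M = cscale (1 / N $ a0 $ b0) N"
      have "M $ a0 $ b0 = 1" using J by (simp add: M_def cscale_def)
      moreover have "M $ a $ b = (\<Sum>j\<in>J. C a j * M $ j $ b)" if "a \<notin> J" for a b
        using C[OF that, of b] by (simp add: M_def cscale_def sum_divide_distrib)
      moreover have "\<forall>i<d. pairing (A i) M = 0"
        using N(2) by (simp add: M_def pairing_cscale)
      ultimately have "\<not> avoid (J, a0, b0) A" unfolding avoid_def by blast
      then show False using A J by blast
    qed
  qed
qed

text \<open>
  The bound on \<open>u\<close> makes the product \<open>(n - r) (m - r)\<close> positive, where \<open>m = n + k\<close>. Either both factors
  are negative and no matrix has a kernel of dimension \<open>r\<close>, or \<open>r\<close> is less than \<open>n\<close> and \<open>m\<close>; then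
  \<open>n m - (n - r) (m - r) = r (n + m - r)\<close> shows that there are enough hyperplanes.
\<close>

theorem corollary2p7:
  fixes k :: int and r u :: nat
  assumes "int CARD('m::finite) = int CARD('n::finite) + k"
    and "int u \<le> (int CARD('n) - int r) * (int CARD('n) + k - int r) - 1"
  shows "for_generic_hyperplanes (CARD('n) * CARD('m) - 1 - u)
           (\<lambda>A. polar_variety (Sigma_bar r :: (complex^'n^'m) set) u A = {})"
proof (cases "CARD('n) < r")
  case True
  have "vec.dim {v. A *v v = 0} \<le> CARD('n)" for A :: "complex^'n^'m"
    using vec.dim_subset_UNIV[of "{v. A *v v = 0}"] by (simp add: vec.dimension_def card_cart_basis)
  then have "(Sigma_bar r :: (complex^'n^'m) set) = {}"
    using True by (auto simp: Sigma_bar_def not_le intro: le_less_trans)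
  then show ?thesis
    by (intro for_generic_hyperplanes_mono[OF for_generic_hyperplanes_True])
      (auto simp: polar_variety_def)
next
  case False
  define d where "d = CARD('n) * CARD('m) - 1 - u"
  have pos: "int u + 1 \<le> (int CARD('n) - int r) * (int CARD('m) - int r)"
    using assms by simp
  have n: "r \<le> CARD('n)" using False by simp
  have m: "r \<le> CARD('m)"
  proof (rule ccontr)
    assume "\<not> r \<le> CARD('m)"
    then have "(int CARD('n) - int r) * (int CARD('m) - int r) \<le> 0"
      using n by (intro mult_nonneg_nonpos) auto
    then show False using pos by linarith
  qed
  have int_diff: "int (CARD('n) + CARD('m) - r) = int CARD('n) + int CARD('m) - int r"
    using n by simp
  have "(int CARD('n) - int r) * (int CARD('m) - int r)
      = int (CARD('n) * CARD('m)) - int (r * (CARD('n) + CARD('m) - r))"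
    unfolding of_nat_mult int_diff by (simp add: algebra_simps)
  then have "r * (CARD('n) + CARD('m) - r) \<le> d"
    using pos unfolding d_def by linarith
  note generic = generic_hyperplanes_miss_row_rank_le[OF n m this]
  show ?thesis
    unfolding d_def[symmetric]
  proof (rule for_generic_hyperplanes_mono[OF generic], rule ccontr)
    fix A :: "nat \<Rightarrow> complex^'n^'m"
    assume A: "\<forall>N. row_rank_le r N \<longrightarrow> (\<forall>i<d. pairing (A i) N = 0) \<longrightarrow> N = 0"
    assume "polar_variety (Sigma_bar r) u A \<noteq> {}"
    then obtain x l where l: "(x, l) \<in> conormal_space (Sigma_bar r)"
      and hyp: "\<And>i. i < d \<Longrightarrow> l \<in> proj_hyperplane (A i)"
      unfolding polar_variety_def d_def by fastforce
    obtain N where N: "l = cmat.span {N}" "N \<noteq> 0" "row_rank_le r N"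
      using conormal_space_row_rank_le[OF l] by blast
    have "pairing (A i) N = 0" if i: "i < d" for i
    proof -
      obtain N' where N': "cmat.span {N} = cmat.span {N'}" "pairing (A i) N' = 0"
        using hyp[OF i] N(1) by (auto simp: proj_hyperplane_def)
      from N'(1) obtain c where "N = cscale c N'" by (rule span_singleton_eq_imp_multiple)
      then show ?thesis using N'(2) by (simp add: pairing_cscale)
    qed
    then show False using A N by blast
  qed
qed

end
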